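(* Let $R$ be a ring with $1$ and center $\mathcal Z$, let $I$ be a two-sided ideal of $R$, and let $\{A_t\}$ be an annihilating sequence of $I$ of (finite) length $l$. Put $\Gamma=1+I$ and $Z=\mathcal Z\cap\Gamma$. Then $$\{1\}\le (A_1+1)Z\le\cdots\le (A_t+1)Z\le\cdots\le (A_{l}+1)Z=\Gamma$$ is a central series of $\Gamma$, and $\Gamma$ is a nilpotent group. Consequently, the nilpotency class of $\Gamma$ is less than or equal to the annihilating length of $I$.
   Context: For an ideal $I$ of a ring, $\operatorname{Ann}(I)=\{a\in I: aI=0=Ia\}$. An annihilating sequence of $I$ is a chain of two-sided ideals of $R$ contained in $I$, $$0=A_0\subset A_1\subset\cdots\subset A_{l}=I,$$ with $A_1=\operatorname{Ann}(I)$ and $A_t/A_{t-1}\subseteq\operatorname{Ann}(I/A_{t-1})$ for $t\ge2$ (i.e. $ab,ba\in A_{t-1}$ for all $a\in A_t$, $b\in I$). Its length is the first $t$ with $A_t=I$. The upper annihilating sequence of $I$ is $I_0=0$, $I_t=\{a\in I: aI\subseteq I_{t-1},\ Ia\subseteq I_{t-1}\}$ for $t\ge1$; the annihilating length of $I$ is the least $d$ with $I_d=I$. $\Gamma=1+I$ is regarded as a subgroup of the group of units of $R$. *)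

theory Defs
  imports "HOL-Algebra.Algebra" "HOL-Library.Extended_Nat"
begin

definition ring_center :: "('a, 'b) ring_scheme \<Rightarrow> 'a set" where
  "ring_center R = {z \<in> carrier R. \<forall>x \<in> carrier R. z \<otimes>\<^bsub>R\<^esub> x = x \<otimes>\<^bsub>R\<^esub> z}"

definition Ann :: "('a, 'b) ring_scheme \<Rightarrow> 'a set \<Rightarrow> 'a set" where
  "Ann R I = {a \<in> I. \<forall>b \<in> I. a \<otimes>\<^bsub>R\<^esub> b = \<zero>\<^bsub>R\<^esub> \<and> b \<otimes>\<^bsub>R\<^esub> a = \<zero>\<^bsub>R\<^esub>}"

(* The sequence is indexed by all of nat, but only its values up to the length l matter.
   Inclusions need not be strict; l is the first index at which the sequence reaches I.
   In particular l = 0 exactly when I = 0, and then there is no condition on A 1. *)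
definition annihilating_sequence ::
    "('a, 'b) ring_scheme \<Rightarrow> 'a set \<Rightarrow> (nat \<Rightarrow> 'a set) \<Rightarrow> nat \<Rightarrow> bool" where
  "annihilating_sequence R I A l \<longleftrightarrow>
     (\<forall>t \<le> l. ideal (A t) R \<and> A t \<subseteq> I) \<and>
     (\<forall>t < l. A t \<subseteq> A (Suc t)) \<and>
     A 0 = {\<zero>\<^bsub>R\<^esub>} \<and>
     (1 \<le> l \<longrightarrow> A 1 = Ann R I) \<and>
     (\<forall>t. 2 \<le> t \<and> t \<le> l \<longrightarrow>
        (\<forall>a \<in> A t. \<forall>b \<in> I. a \<otimes>\<^bsub>R\<^esub> b \<in> A (t - 1) \<and> b \<otimes>\<^bsub>R\<^esub> a \<in> A (t - 1))) \<and>
     A l = I \<and> (\<forall>t < l. A t \<noteq> I)"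

primrec upper_annihilating_sequence ::
    "('a, 'b) ring_scheme \<Rightarrow> 'a set \<Rightarrow> nat \<Rightarrow> 'a set" where
  "upper_annihilating_sequence R I 0 = {\<zero>\<^bsub>R\<^esub>}"
| "upper_annihilating_sequence R I (Suc t) =
     {a \<in> I. \<forall>b \<in> I. a \<otimes>\<^bsub>R\<^esub> b \<in> upper_annihilating_sequence R I t \<and>
                    b \<otimes>\<^bsub>R\<^esub> a \<in> upper_annihilating_sequence R I t}"

(* Infinite if the upper annihilating sequence never reaches I. *)
definition annihilating_length :: "('a, 'b) ring_scheme \<Rightarrow> 'a set \<Rightarrow> enat" where
  "annihilating_length R I = (INF d \<in> {d. upper_annihilating_sequence R I d = I}. enat d)"

definition one_plus :: "('a, 'b) ring_scheme \<Rightarrow> 'a set \<Rightarrow> 'a set" where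
  "one_plus R I = I +>\<^bsub>R\<^esub> \<one>\<^bsub>R\<^esub>"

definition one_plus_group :: "('a, 'b) ring_scheme \<Rightarrow> 'a set \<Rightarrow> 'a monoid" where
  "one_plus_group R I = (units_of R)\<lparr>carrier := one_plus R I\<rparr>"

definition group_center :: "('a, 'b) monoid_scheme \<Rightarrow> 'a set" where
  "group_center G = {z \<in> carrier G. \<forall>x \<in> carrier G. z \<otimes>\<^bsub>G\<^esub> x = x \<otimes>\<^bsub>G\<^esub> z}"

(* A central series 1 = H 0 \<le> H 1 \<le> ... \<le> H n = G of length n: the image of H (i + 1)
   in G / H i is contained in the center of G / H i. Repetitions are allowed. *)
definition central_series ::
    "('a, 'b) monoid_scheme \<Rightarrow> (nat \<Rightarrow> 'a set) \<Rightarrow> nat \<Rightarrow> bool" where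
  "central_series G H n \<longleftrightarrow>
     (\<forall>i \<le> n. H i \<lhd> G) \<and>
     H 0 = {\<one>\<^bsub>G\<^esub>} \<and> H n = carrier G \<and>
     (\<forall>i < n. H i \<subseteq> H (Suc i) \<and>
        (\<lambda>x. H i #>\<^bsub>G\<^esub> x) ` H (Suc i) \<subseteq> group_center (G Mod H i))"

definition nilpotent_group :: "('a, 'b) monoid_scheme \<Rightarrow> bool" where
  "nilpotent_group G \<longleftrightarrow> group G \<and> (\<exists>H n. central_series G H n)"

(* The length of a shortest central series, infinite if there is none. *)
definition nilpotency_class :: "('a, 'b) monoid_scheme \<Rightarrow> enat" where
  "nilpotency_class G = (INF n \<in> {n. \<exists>H. central_series G H n}. enat n)"

end

theory Submission
  imports Defs
begin

text \<open>Consider a chain \<open>0 = J\<^sub>0 \<subseteq> \<dots> \<subseteq> J\<^sub>l = I\<close> of ideals such that \<open>ab\<close> and \<open>ba\<close> lie in \<open>J\<^sub>t\<close> for all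
  \<open>a \<in> J\<^bsub>t+1\<^esub>\<close>, \<open>b \<in> I\<close>; annihilating sequences and upper annihilating sequences that reach \<open>I\<close> are such
  chains. The identity \<open>(1 + a)(1 - a) = 1 - a\<^sup>2\<close> shows inductively that \<open>1 + J\<^sub>t\<close> consists of units.
  For \<open>x = (1 + a) z\<close> and \<open>y = 1 + b\<close> with \<open>a \<in> J\<^bsub>t+1\<^esub>\<close>, \<open>b \<in> I\<close> and \<open>z\<close> central, the difference
  \<open>xy - yx = (ab - ba) z\<close> lies in \<open>J\<^sub>t\<close>, so the unit \<open>xy (yx)\<^sup>-\<^sup>1\<close> lies
  in \<open>1 + J\<^sub>t\<close>.\<close>

section \<open>The sets \<open>1 + K\<close> for ideals \<open>K\<close>\<close>

lemma mem_one_plus_iff: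
  fixes R (structure)
  shows "x \<in> one_plus R K \<longleftrightarrow> (\<exists>k\<in>K. x = k \<oplus> \<one>)"
  by (auto simp: one_plus_def a_r_coset_def')

lemma one_plus_mono:
  fixes R (structure)
  shows "K \<subseteq> L \<Longrightarrow> one_plus R K \<subseteq> one_plus R L"
  unfolding one_plus_def a_r_coset_def' by blast

lemma (in ideal) one_plus_closed: "one_plus R I \<subseteq> carrier R"
  using a_Hcarr by (auto simp: mem_one_plus_iff)

lemma (in ideal) one_mem_one_plus: "\<one> \<in> one_plus R I"
  unfolding mem_one_plus_iff by (rule bexI[of _ "\<zero>"]) auto

lemma (in ideal) one_plus_mult_closed:
  assumes "x \<in> one_plus R I" "y \<in> one_plus R I"
  shows "x \<otimes> y \<in> one_plus R I"
proof -
  from assms obtain a b where ab: "a \<in> I" "x = a \<oplus> \<one>" "b \<in> I" "y = b \<oplus> \<one>"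
    by (auto simp: mem_one_plus_iff)
  have "x \<otimes> y = (a \<otimes> b \<oplus> a \<oplus> b) \<oplus> \<one>"
    using ab a_Hcarr by (simp add: l_distr r_distr a_ac)
  moreover have "a \<otimes> b \<oplus> a \<oplus> b \<in> I"
    using ab a_Hcarr by (simp add: I_l_closed)
  ultimately show ?thesis
    by (auto simp: mem_one_plus_iff)
qed

text \<open>Multiplying out \<open>(a + 1) inv x = 1\<close> gives
  \<open>inv x = 1 - a (inv x)\<close>, and \<open>a (inv x)\<close> lies in the ideal.\<close>

lemma (in ideal) one_plus_inv_closed:
  assumes "x \<in> one_plus R I" "x \<in> Units R"
  shows "inv x \<in> one_plus R I"
proof -
  from assms obtain a where a: "a \<in> I" "x = a \<oplus> \<one>"
    by (auto simp: mem_one_plus_iff)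
  have car: "inv x \<in> carrier R" "a \<in> carrier R"
    using assms a a_Hcarr by auto
  have "\<one> = a \<otimes> inv x \<oplus> inv x"
    using Units_r_inv[OF assms(2)] car by (simp add: a(2) l_distr)
  then have "inv x = \<ominus> (a \<otimes> inv x) \<oplus> \<one>"
    using car by (metis l_neg m_closed a_assoc a_inv_closed l_zero)
  moreover have "\<ominus> (a \<otimes> inv x) \<in> I"
    using a car by (simp add: I_r_closed)
  ultimately show ?thesis
    unfolding mem_one_plus_iff by blast
qed

lemma (in ideal) one_plus_subgroup:
  assumes "one_plus R I \<subseteq> Units R"
  shows "subgroup (one_plus R I) (units_of R)"
proof -
  interpret U: group "units_of R" by (rule units_group)
  show ?thesis
  proof (rule U.subgroupI)
    show "one_plus R I \<subseteq> carrier (units_of R)"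
      using assms by (simp add: units_of_carrier)
    show "one_plus R I \<noteq> {}"
      using one_mem_one_plus by auto
    show "inv\<^bsub>units_of R\<^esub> a \<in> one_plus R I" if "a \<in> one_plus R I" for a
      using that assms one_plus_inv_closed by (simp add: subsetD units_of_inv)
    show "a \<otimes>\<^bsub>units_of R\<^esub> b \<in> one_plus R I" if "a \<in> one_plus R I" "b \<in> one_plus R I" for a b
      using that one_plus_mult_closed by (simp add: units_of_mult)
  qed
qed

text \<open>With \<open>w\<close> the inverse of the product, \<open>y w\<close> is a right inverse
  and \<open>w y\<close> a left inverse of \<open>x\<close>, so the two coincide. It serves to pass
  from \<open>1 - a^2\<close> to its factor \<open>1 + a\<close>.\<close>

lemma (in monoid) Units_if_mult_commute_Units:
  assumes "x \<in> carrier G" "y \<in> carrier G" "x \<otimes> y = y \<otimes> x" "x \<otimes> y \<in> Units G"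
  shows "x \<in> Units G"
proof -
  let ?w = "inv (x \<otimes> y)"
  have w: "?w \<in> carrier G" using assms by simp
  have r: "x \<otimes> (y \<otimes> ?w) = \<one>"
    using assms w by (metis Units_r_inv m_assoc)
  have l: "(?w \<otimes> y) \<otimes> x = \<one>"
    using assms w by (metis Units_l_inv m_assoc)
  have "?w \<otimes> y = y \<otimes> ?w"
    using inv_unique[OF l r] assms w by simp
  then show ?thesis
    using l r assms w unfolding Units_def by auto
qed

lemma (in ring) ring_center_subset: "ring_center R \<subseteq> carrier R"
  by (auto simp: ring_center_def)

lemma (in ring) ring_center_commute:
  "z \<in> ring_center R \<Longrightarrow> x \<in> carrier R \<Longrightarrow> z \<otimes> x = x \<otimes> z"
  by (simp add: ring_center_def)

section \<open>The central series attached to a chain of ideals\<close>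

locale annihilating_filtration = ideal I R for I and R (structure) +
  fixes J :: "nat \<Rightarrow> 'a set" and l :: nat
  assumes J_ideal: "t \<le> l \<Longrightarrow> ideal (J t) R"
    and J_0: "J 0 = {\<zero>}"
    and J_l: "J l = I"
    and J_Suc: "t < l \<Longrightarrow> J t \<subseteq> J (Suc t)"
    and J_mult: "t < l \<Longrightarrow> a \<in> J (Suc t) \<Longrightarrow> b \<in> I \<Longrightarrow> a \<otimes> b \<in> J t \<and> b \<otimes> a \<in> J t"
begin

abbreviation \<Gamma> where "\<Gamma> \<equiv> one_plus_group R I"
abbreviation Z where "Z \<equiv> ring_center R \<inter> one_plus R I"
text \<open>The value at \<open>0\<close> is set apart so that the series starts at the trivial
  subgroup; the general formula would give \<open>Z\<close> there, as
  \<open>one_plus R (J 0)\<close> contains only the identity.\<close>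

abbreviation H where "H \<equiv> \<lambda>t. if t = 0 then {\<one>} else one_plus R (J t) <#> Z"

lemma J_subset: "t \<le> l \<Longrightarrow> J t \<subseteq> I"
proof (induction rule: inc_induct)
  case base
  show ?case by (simp add: J_l)
next
  case (step t)
  then show ?case using J_Suc by blast
qed

lemma one_plus_J_Units:
  assumes "t \<le> l" "a \<in> J t"
  shows "a \<oplus> \<one> \<in> Units R"
  using assms
proof (induction t arbitrary: a)
  case 0
  then show ?case by (simp add: J_0)
next
  case (Suc t)
  then have aI: "a \<in> I" using J_subset by blast
  then have a: "a \<in> carrier R" by (rule a_Hcarr)
  interpret Jt: ideal "J t" R using Suc.prems J_ideal by simp
  \<comment> \<open>Here \<open>J_mult\<close> is taken with \<open>b = a\<close>; it lowers the
    square by one level, so the induction hypothesis covers its negative.\<close>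
  have "a \<otimes> a \<in> J t" using J_mult Suc.prems aI by simp
  then have u: "\<ominus> (a \<otimes> a) \<oplus> \<one> \<in> Units R"
    using Suc.IH Suc.prems by simp
  \<comment> \<open>This is the cancellation that remains once the products below are expanded and
    their summands sorted.\<close>
  have "a \<oplus> (\<one> \<oplus> (\<ominus> a \<oplus> \<ominus> (a \<otimes> a))) = \<one> \<oplus> \<ominus> (a \<otimes> a)"
    using a by (subst a_lcomm) (simp_all add: r_neg2)
  then have e: "(a \<oplus> \<one>) \<otimes> (\<ominus> a \<oplus> \<one>) = \<ominus> (a \<otimes> a) \<oplus> \<one>" "(\<ominus> a \<oplus> \<one>) \<otimes> (a \<oplus> \<one>) = \<ominus> (a \<otimes> a) \<oplus> \<one>"
    using a by (simp_all add: l_distr r_distr l_minus r_minus minus_add a_ac)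
  show ?case
    by (rule Units_if_mult_commute_Units[of _ "\<ominus> a \<oplus> \<one>"]) (use a u e in auto)
qed

section \<open>The group \<Gamma> and its normal subgroups\<close>

lemma one_plus_Units: "one_plus R I \<subseteq> Units R"
  using one_plus_J_Units[of l] by (auto simp: mem_one_plus_iff J_l)

lemma subgroup_one_plus: "subgroup (one_plus R I) (units_of R)"
  using one_plus_Units by (rule one_plus_subgroup)

lemma carrier_\<Gamma> [simp]: "carrier \<Gamma> = one_plus R I"
  and mult_\<Gamma> [simp]: "x \<otimes>\<^bsub>\<Gamma>\<^esub> y = x \<otimes> y"
  and one_\<Gamma> [simp]: "\<one>\<^bsub>\<Gamma>\<^esub> = \<one>"
  by (simp_all add: one_plus_group_def units_of_def)

lemma set_mult_\<Gamma> [simp]: "B <#>\<^bsub>\<Gamma>\<^esub> C = B <#> C"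
  by (simp add: set_mult_def)

lemma group_\<Gamma>: "group \<Gamma>"
  unfolding one_plus_group_def
  using subgroup_one_plus units_group by (rule subgroup.subgroup_is_group)

sublocale \<Gamma>: group \<Gamma>
  by (rule group_\<Gamma>)

lemma inv_\<Gamma> [simp]:
  assumes "x \<in> one_plus R I"
  shows "inv\<^bsub>\<Gamma>\<^esub> x = inv x"
proof -
  have "inv\<^bsub>\<Gamma>\<^esub> x = inv\<^bsub>units_of R\<^esub> x"
    unfolding one_plus_group_def
    using group.m_inv_consistent[OF units_group subgroup_one_plus assms] .
  then show ?thesis
    using assms one_plus_Units by (simp add: subsetD units_of_inv)
qed

text \<open>Conjugation fixes the summand \<open>1\<close>:
  \<open>x (k + 1) (inv x) = x k (inv x) + 1\<close>, and a two-sided ideal contains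
  \<open>x k (inv x)\<close>.\<close>

lemma normal_one_plus:
  assumes "ideal K R" "K \<subseteq> I"
  shows "one_plus R K \<lhd> \<Gamma>"
proof -
  interpret K: ideal K R by fact
  have sub: "one_plus R K \<subseteq> one_plus R I"
    using assms(2) by (rule one_plus_mono)
  have "subgroup (one_plus R K) \<Gamma>"
  proof (rule \<Gamma>.subgroupI)
    show "inv\<^bsub>\<Gamma>\<^esub> a \<in> one_plus R K" if "a \<in> one_plus R K" for a
      using that sub one_plus_Units K.one_plus_inv_closed by (simp add: subsetD)
  qed (use sub K.one_mem_one_plus K.one_plus_mult_closed in auto)
  moreover have "x \<otimes> h \<otimes> inv x \<in> one_plus R K" if x: "x \<in> one_plus R I" and "h \<in> one_plus R K" for x h
  proof -
    from that obtain k where k: "k \<in> K" "h = k \<oplus> \<one>"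
      by (auto simp: mem_one_plus_iff)
    have xu: "x \<in> Units R" using x one_plus_Units by blast
    then have "x \<otimes> h \<otimes> inv x = x \<otimes> k \<otimes> inv x \<oplus> \<one>"
      using K.a_Hcarr[OF k(1)] by (simp add: k(2) r_distr l_distr Units_closed Units_r_inv)
    moreover have "x \<otimes> k \<otimes> inv x \<in> K"
      using k xu by (simp add: Units_closed K.I_l_closed K.I_r_closed)
    ultimately show ?thesis by (auto simp: mem_one_plus_iff)
  qed
  ultimately show ?thesis
    by (simp add: \<Gamma>.normal_inv_iff)
qed

lemma one_mem_Z: "\<one> \<in> Z"
  using one_mem_one_plus by (simp add: ring_center_def)

lemma normal_Z: "Z \<lhd> \<Gamma>"
proof -
  have "subgroup Z \<Gamma>"
  proof (rule \<Gamma>.subgroupI)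
    fix z assume z: "z \<in> Z"
    then have zu: "z \<in> Units R" using one_plus_Units by auto
    have "inv z \<otimes> x = x \<otimes> inv z" if x: "x \<in> carrier R" for x
    proof -
      \<comment> \<open>Inserting \<open>z (inv z)\<close> on the right lets \<open>z\<close> move
        past \<open>x\<close>, which carries centrality over to the inverse.\<close>
      have "inv z \<otimes> x = inv z \<otimes> (x \<otimes> z) \<otimes> inv z"
        using x zu by (simp add: m_assoc Units_closed Units_r_inv)
      also have "\<dots> = inv z \<otimes> (z \<otimes> x) \<otimes> inv z"
        using x z ring_center_commute by simp
      also have "\<dots> = x \<otimes> inv z"
        using x zu by (simp add: m_assoc[symmetric] Units_closed Units_l_inv)
      finally show ?thesis .
    qed
    then have "inv z \<in> ring_center R"
      unfolding ring_center_def using zu by blast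
    then show "inv\<^bsub>\<Gamma>\<^esub> z \<in> Z"
      using z zu one_plus_inv_closed by simp
  next
    fix x y assume xy: "x \<in> Z" "y \<in> Z"
    have "x \<otimes> y \<otimes> w = w \<otimes> (x \<otimes> y)" if "w \<in> carrier R" for w
    proof -
      have car: "x \<in> carrier R" "y \<in> carrier R"
        using xy ring_center_subset by auto
      have "x \<otimes> y \<otimes> w = x \<otimes> (w \<otimes> y)"
        using car that xy ring_center_commute[of y w] by (simp add: m_assoc)
      also have "\<dots> = w \<otimes> x \<otimes> y"
        using car that xy ring_center_commute[of x w] by (simp flip: m_assoc)
      finally show ?thesis using car that by (simp add: m_assoc)
    qed
    moreover have "x \<otimes> y \<in> carrier R"
      using xy ring_center_subset by auto
    ultimately have "x \<otimes> y \<in> ring_center R"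
      unfolding ring_center_def by blast
    then show "x \<otimes>\<^bsub>\<Gamma>\<^esub> y \<in> Z"
      using xy one_plus_mult_closed by simp
  next
    show "Z \<noteq> {}" using one_mem_Z by blast
  qed auto
  moreover have "x \<otimes> h \<otimes> inv x \<in> Z" if x: "x \<in> one_plus R I" and h: "h \<in> Z" for x h
  proof -
    have xu: "x \<in> Units R" using x one_plus_Units by blast
    have "h \<in> carrier R" using h ring_center_subset by auto
    moreover have "x \<otimes> h = h \<otimes> x"
      using h xu ring_center_commute[of h x] by (simp add: Units_closed)
    ultimately have "x \<otimes> h \<otimes> inv x = h"
      using xu by (simp add: m_assoc Units_closed Units_r_inv)
    with h show ?thesis by simp
  qed
  ultimately show ?thesis
    by (simp add: \<Gamma>.normal_inv_iff)
qed

section \<open>Terms and factors of the series\<close>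

lemma normal_H: "t \<le> l \<Longrightarrow> H t \<lhd> \<Gamma>"
  using \<Gamma>.one_is_normal \<Gamma>.normal_subgroup_set_mult_closed[OF normal_one_plus normal_Z]
    J_ideal J_subset by auto

lemma one_plus_set_mult_Z: "one_plus R I <#> Z = one_plus R I"
proof
  show "one_plus R I <#> Z \<subseteq> one_plus R I"
    using one_plus_mult_closed by (auto simp: set_mult_def)
  have "x = x \<otimes> \<one>" if "x \<in> one_plus R I" for x
    using that one_plus_closed by (simp add: subsetD)
  then show "one_plus R I \<subseteq> one_plus R I <#> Z"
    using one_mem_Z by (force simp: set_mult_def)
qed

text \<open>Commutators will be located in \<open>1 + J t\<close>; this places them in
  \<open>H t\<close> also for \<open>t = 0\<close>, where \<open>H\<close> has its exceptional
  value.\<close>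

lemma one_plus_J_subset_H: "t \<le> l \<Longrightarrow> one_plus R (J t) \<subseteq> H t"
proof (cases "t = 0")
  case True
  then show ?thesis by (auto simp: mem_one_plus_iff J_0)
next
  case False
  assume "t \<le> l"
  then have "one_plus R (J t) \<subseteq> carrier R"
    using ideal.one_plus_closed J_ideal by blast
  then have "x = x \<otimes> \<one>" if "x \<in> one_plus R (J t)" for x
    using that by (simp add: subsetD)
  then show ?thesis
    using one_mem_Z False by (force simp: set_mult_def)
qed

text \<open>The element \<open>h\<close> is the commutator \<open>xy (yx)^-1\<close>; the equation
  says that \<open>x\<close> and \<open>y\<close> commute modulo \<open>H t\<close>.\<close>

lemma H_Suc_commute_mod:
  assumes t: "t < l" and x: "x \<in> H (Suc t)" and y: "y \<in> one_plus R I"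
  shows "\<exists>h\<in>H t. x \<otimes> y = h \<otimes> (y \<otimes> x)"
proof -
  interpret Jt: ideal "J t" R using t J_ideal by simp
  obtain k z where k: "k \<in> one_plus R (J (Suc t))" and z: "z \<in> Z" and kz: "x = k \<otimes> z"
    using x by (auto simp: set_mult_def)
  obtain a where a: "a \<in> J (Suc t)" and ka: "k = a \<oplus> \<one>"
    using k by (auto simp: mem_one_plus_iff)
  have xz: "x = (a \<oplus> \<one>) \<otimes> z"
    using kz ka by simp
  obtain b where b: "b \<in> I" "y = b \<oplus> \<one>"
    using y by (auto simp: mem_one_plus_iff)
  have aI: "a \<in> I" using a J_subset[of "Suc t"] t by auto
  have car: "a \<in> carrier R" "b \<in> carrier R" "z \<in> carrier R"
    using aI b z a_Hcarr ring_center_subset by auto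
  have "x \<in> one_plus R I"
    unfolding xz using aI z by (intro one_plus_mult_closed) (auto simp: mem_one_plus_iff)
  then have yx: "y \<otimes> x \<in> Units R" and y': "y \<in> Units R"
    using y one_plus_Units by auto
  \<comment> \<open>The aim is the witness \<open>c w + 1\<close>, where \<open>c\<close> is the
    difference \<open>xy - yx\<close>: since \<open>w\<close> inverts \<open>yx\<close>, the product
    \<open>(c w + 1) yx\<close> equals \<open>c + yx = xy\<close>.\<close>
  define w where "w = inv (y \<otimes> x)"
  have w: "w \<in> carrier R" using yx by (simp add: w_def)
  define c where "c = (a \<otimes> b \<ominus> b \<otimes> a) \<otimes> z"
  have cJ: "c \<in> J t"
    using J_mult[OF t a b(1)] car unfolding c_def minus_eq
    by (intro Jt.I_r_closed) auto
  \<comment> \<open>Moving \<open>z\<close> past \<open>y\<close> puts \<open>z\<close> at the right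
    end of both \<open>xy\<close> and \<open>yx\<close>, so that only \<open>1 + a\<close> and
    \<open>1 + b\<close> have to be interchanged.\<close>
  have "z \<otimes> y = y \<otimes> z" using z y' ring_center_commute[of z y] by (simp add: Units_closed)
  then have "x \<otimes> y = ((a \<oplus> \<one>) \<otimes> (b \<oplus> \<one>)) \<otimes> z"
    using car unfolding xz b(2) by (simp add: m_assoc)
  also have "(a \<oplus> \<one>) \<otimes> (b \<oplus> \<one>) = (a \<otimes> b \<ominus> b \<otimes> a) \<oplus> (b \<oplus> \<one>) \<otimes> (a \<oplus> \<one>)"
    using car by (simp add: minus_eq l_distr r_distr a_ac r_neg1 r_neg2 r_neg)
  also have "\<dots> \<otimes> z = c \<oplus> y \<otimes> x"
    using car unfolding c_def xz b(2) by (simp add: l_distr m_assoc)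
  also have "\<dots> = (c \<otimes> w \<oplus> \<one>) \<otimes> (y \<otimes> x)"
    using yx Jt.a_Hcarr[OF cJ] w Units_l_inv[OF yx]
    by (simp add: l_distr m_assoc[of c w "y \<otimes> x"] Units_closed flip: w_def)
  finally have "x \<otimes> y = (c \<otimes> w \<oplus> \<one>) \<otimes> (y \<otimes> x)" .
  moreover have "c \<otimes> w \<oplus> \<one> \<in> one_plus R (J t)"
    using Jt.I_r_closed[OF cJ w] by (auto simp: mem_one_plus_iff)
  then have "c \<otimes> w \<oplus> \<one> \<in> H t"
    by (rule subsetD[OF one_plus_J_subset_H[OF less_imp_le[OF t]]])
  ultimately show ?thesis by blast
qed

text \<open>By the previous relation \<open>xy\<close> and \<open>yx\<close> lie in the same right
  coset of \<open>H t\<close>, and products of cosets are computed on representatives.\<close>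

lemma H_Suc_central:
  assumes t: "t < l"
  shows "(\<lambda>x. H t #>\<^bsub>\<Gamma>\<^esub> x) ` H (Suc t) \<subseteq> group_center (\<Gamma> Mod H t)"
proof (rule image_subsetI)
  fix x assume x: "x \<in> H (Suc t)"
  interpret N: normal "H t" \<Gamma> using t normal_H by simp
  have "H (Suc t) \<subseteq> carrier \<Gamma>"
    using t by (intro subgroup.subset normal_imp_subgroup normal_H) simp
  then have x': "x \<in> carrier \<Gamma>" using x by blast
  have "(H t #>\<^bsub>\<Gamma>\<^esub> x) <#>\<^bsub>\<Gamma>\<^esub> (H t #>\<^bsub>\<Gamma>\<^esub> y) = (H t #>\<^bsub>\<Gamma>\<^esub> y) <#>\<^bsub>\<Gamma>\<^esub> (H t #>\<^bsub>\<Gamma>\<^esub> x)"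
    if y: "y \<in> carrier \<Gamma>" for y
  proof -
    obtain h where "h \<in> H t" "x \<otimes>\<^bsub>\<Gamma>\<^esub> y = h \<otimes>\<^bsub>\<Gamma>\<^esub> (y \<otimes>\<^bsub>\<Gamma>\<^esub> x)"
      using H_Suc_commute_mod[OF t x] y by auto
    then have "x \<otimes>\<^bsub>\<Gamma>\<^esub> y \<in> H t #>\<^bsub>\<Gamma>\<^esub> (y \<otimes>\<^bsub>\<Gamma>\<^esub> x)"
      unfolding r_coset_def by blast
    then have "H t #>\<^bsub>\<Gamma>\<^esub> (x \<otimes>\<^bsub>\<Gamma>\<^esub> y) = H t #>\<^bsub>\<Gamma>\<^esub> (y \<otimes>\<^bsub>\<Gamma>\<^esub> x)"
      using \<Gamma>.repr_independence[OF _ _ N.subgroup_axioms] \<Gamma>.m_closed x' y by metis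
    then show ?thesis
      using N.rcos_sum x' y by metis
  qed
  then show "H t #>\<^bsub>\<Gamma>\<^esub> x \<in> group_center (\<Gamma> Mod H t)"
    using x' unfolding group_center_def carrier_FactGroup mult_FactGroup by blast
qed

lemma H_mono:
  assumes "t < l"
  shows "H t \<subseteq> H (Suc t)"
proof (cases "t = 0")
  case True
  interpret subgroup "H (Suc t)" \<Gamma>
    using assms by (intro normal_imp_subgroup normal_H) simp
  show ?thesis using True one_closed by simp
next
  case False
  have "one_plus R (J t) \<subseteq> one_plus R (J (Suc t))"
    using J_Suc[OF assms] by (rule one_plus_mono)
  then show ?thesis using False by (simp add: mono_set_mult)
qed

lemma central_series_H: "central_series \<Gamma> H l"
proof -
  have "H l = carrier \<Gamma>"
  \<comment> \<open>For \<open>l = 0\<close> the top term is the exceptional value of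
    \<open>H\<close>; it is all of \<Gamma> because \<open>I = J 0\<close> is zero.\<close>
  proof (cases "l = 0")
    case True
    then have "I = {\<zero>}" using J_0 J_l by simp
    then have "one_plus R I = {\<one>}" by (auto simp: mem_one_plus_iff)
    then show ?thesis using True by simp
  qed (simp add: J_l one_plus_set_mult_Z)
  then show ?thesis
    unfolding central_series_def using normal_H H_mono H_Suc_central by simp
qed

lemma nilpotency_class_le: "nilpotency_class \<Gamma> \<le> enat l"
  unfolding nilpotency_class_def using central_series_H by (intro INF_lower) blast

end

section \<open>The two kinds of annihilating sequences as chains\<close>

lemma (in ideal) annihilating_filtration_of_sequence:
  assumes "annihilating_sequence R I A l"
  shows "annihilating_filtration I R A l"
proof (intro annihilating_filtration.intro ideal_axioms annihilating_filtration_axioms.intro)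
  note A = assms[unfolded annihilating_sequence_def]
  show "ideal (A t) R" if "t \<le> l" for t using A that by blast
  show "A 0 = {\<zero>}" "A l = I" using A by auto
  show "A t \<subseteq> A (Suc t)" if "t < l" for t using A that by blast
  show "a \<otimes> b \<in> A t \<and> b \<otimes> a \<in> A t" if "t < l" "a \<in> A (Suc t)" "b \<in> I" for t a b
  \<comment> \<open>For \<open>t = 0\<close> the products vanish because \<open>A 1\<close> is
    \<open>Ann R I\<close>; for larger \<open>t\<close> the condition on annihilating sequences
    applies at index \<open>Suc t\<close>, which is at least \<open>2\<close>.\<close>
  proof (cases t)
    case 0
    then show ?thesis using A that by (simp add: Ann_def)
  next
    case (Suc s)
    then have "2 \<le> Suc t" "Suc t \<le> l" "Suc t - 1 = t" using that by auto
    then show ?thesis using A that by metis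
  qed
qed

lemma (in ideal) upper_annihilating_sequence_ideal:
  "ideal (upper_annihilating_sequence R I t) R \<and> upper_annihilating_sequence R I t \<subseteq> I"
proof (induction t)
  case 0
  then show ?case using zeroideal by simp
next
  case (Suc t)
  let ?J = "upper_annihilating_sequence R I t"
  let ?K = "upper_annihilating_sequence R I (Suc t)"
  interpret Jt: ideal ?J R using Suc by simp
  have "ideal ?K R"
  proof (rule idealI)
    show "ring R" by (rule ring_axioms)
    show "subgroup ?K (add_monoid R)"
    proof (rule add.subgroupI)
      show "?K \<subseteq> carrier R" using a_Hcarr by auto
      have "\<zero> \<in> ?K" using a_Hcarr by simp
      then show "?K \<noteq> {}" by blast
      show "\<ominus> a \<in> ?K" if "a \<in> ?K" for a
        using that a_Hcarr by (auto simp: l_minus r_minus)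
      show "a \<oplus> b \<in> ?K" if "a \<in> ?K" "b \<in> ?K" for a b
        using that a_Hcarr by (auto simp: l_distr r_distr)
    qed
    show "x \<otimes> a \<in> ?K" if "a \<in> ?K" "x \<in> carrier R" for a x
    proof -
      have "x \<otimes> a \<otimes> b \<in> ?J \<and> b \<otimes> (x \<otimes> a) \<in> ?J" if b: "b \<in> I" for b
      proof -
        \<comment> \<open>Reassociation moves \<open>x\<close> either outside \<open>a b\<close>,
          where it is absorbed by the ideal \<open>?J\<close>, or onto \<open>b\<close>, where it is
          absorbed by \<open>I\<close>.\<close>
        have "x \<otimes> (a \<otimes> b) \<in> ?J" "(b \<otimes> x) \<otimes> a \<in> ?J"
          using \<open>a \<in> ?K\<close> \<open>x \<in> carrier R\<close> b by (auto simp: Jt.I_l_closed I_r_closed)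
        then show ?thesis
          using \<open>a \<in> ?K\<close> \<open>x \<in> carrier R\<close> b a_Hcarr by (simp add: m_assoc)
      qed
      then show ?thesis using that by (auto simp: I_l_closed)
    qed
    show "a \<otimes> x \<in> ?K" if "a \<in> ?K" "x \<in> carrier R" for a x
    proof -
      have "a \<otimes> x \<otimes> b \<in> ?J \<and> b \<otimes> (a \<otimes> x) \<in> ?J" if b: "b \<in> I" for b
      proof -
        have "a \<otimes> (x \<otimes> b) \<in> ?J" "(b \<otimes> a) \<otimes> x \<in> ?J"
          using \<open>a \<in> ?K\<close> \<open>x \<in> carrier R\<close> b by (auto simp: Jt.I_r_closed I_l_closed)
        then show ?thesis
          using \<open>a \<in> ?K\<close> \<open>x \<in> carrier R\<close> b a_Hcarr by (simp add: m_assoc)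
      qed
      then show ?thesis using that by (auto simp: I_r_closed)
    qed
  qed
  then show ?case by auto
qed

text \<open>The sequence increases because each term is an ideal: products of its elements with
  elements of \<open>I\<close> stay in it. The multiplication condition is the recursion
  itself.\<close>

lemma (in ideal) annihilating_filtration_of_upper:
  assumes "upper_annihilating_sequence R I d = I"
  shows "annihilating_filtration I R (upper_annihilating_sequence R I) d"
proof (intro annihilating_filtration.intro ideal_axioms annihilating_filtration_axioms.intro)
  show "upper_annihilating_sequence R I t \<subseteq> upper_annihilating_sequence R I (Suc t)" for t
  proof -
    interpret Jt: ideal "upper_annihilating_sequence R I t" R
      using upper_annihilating_sequence_ideal by simp
    show ?thesis
      using upper_annihilating_sequence_ideal[of t] Jt.I_l_closed Jt.I_r_closed a_Hcarr by auto
  qed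
qed (use assms upper_annihilating_sequence_ideal in auto)

text \<open>Each \<open>d\<close> at which the upper sequence equals \<open>I\<close> yields a
  central series of length \<open>d\<close>. If there is no such \<open>d\<close>, the infimum is
  infinite and the bound trivial.\<close>

lemma (in ideal) nilpotency_class_le_annihilating_length:
  "nilpotency_class (one_plus_group R I) \<le> annihilating_length R I"
  unfolding annihilating_length_def
  by (rule INF_greatest)
    (auto intro: annihilating_filtration.nilpotency_class_le annihilating_filtration_of_upper)

theorem theorem3p3:
  fixes R :: "('a, 'b) ring_scheme" (structure)
    and I :: "'a set" and A :: "nat \<Rightarrow> 'a set" and l :: nat
  defines "Z \<equiv> ring_center R \<inter> one_plus R I"
  assumes "ring R"
    and "ideal I R"
    and "annihilating_sequence R I A l"
  shows "subgroup (one_plus R I) (units_of R)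
    \<and> central_series (one_plus_group R I)
        (\<lambda>t. if t = 0 then {\<one>} else one_plus R (A t) <#> Z) l
    \<and> one_plus R (A l) <#> Z = one_plus R I
    \<and> nilpotent_group (one_plus_group R I)
    \<and> nilpotency_class (one_plus_group R I) \<le> annihilating_length R I"
proof -
  interpret I: ideal I R by fact
  interpret annihilating_filtration I R A l
    using assms(4) by (rule I.annihilating_filtration_of_sequence)
  show ?thesis
    unfolding Z_def nilpotent_group_def
    using subgroup_one_plus central_series_H one_plus_set_mult_Z J_l group_\<Gamma>
      I.nilpotency_class_le_annihilating_length by auto
qed

end
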